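(* Let $N\ge 1$ be an integer, let $\mu>0$, let $f\colon\mathbb{R}^d\to\mathbb{R}\cup\{\infty\}$ be closed, convex, and proper, and let $g\colon\mathbb{R}^d\to\mathbb{R}\cup\{\infty\}$ be closed, proper, and $\mu$-strongly convex. Assume that there exist a primal solution $x_\star\in\operatorname{argmin}(f+g)$ and a dual solution $u_\star$ satisfying $u_\star\in\partial g(x_\star)$ and $-u_\star\in\partial f(x_\star)$. Let $x_0,u_0\in\mathbb{R}^d$ be arbitrary, set \[ \eta_k=\frac{2N\mu}{1+4kN\mu^2},\qquad k=0,\dots,N, \] and let the iterates be generated by the Fast Douglas--Rachford Splitting method (FDR): $w_0=x_0-\eta_0u_0$ and, for $k=0,\dots,N-1$, \begin{align*} y_{k+1}&=\mathrm{prox}_{\eta_k g}(2x_k-w_k),\\ w_{k+1}&=\Bigl(1+\frac{\eta_{k+1}}{\eta_k}\Bigr)y_{k+1}-\frac{\eta_{k+1}}{\eta_k}(2x_k-w_k),\\ x_{k+1}&=\mathrm{prox}_{\eta_{k+1}f}(w_{k+1}). \end{align*} Then \[ \|x_N-x_\star\|^2\le\frac{\|x_0-x_\star\|^2+\|u_0-u_\star\|^2}{1+4N^2\mu^2}. \]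
   Context: $\|\cdot\|$ is the Euclidean norm on $\mathbb{R}^d$. A function is closed if its epigraph is closed, and proper if it never equals $-\infty$ and is finite somewhere. The function $g$ is $\mu$-strongly convex if $g-\frac{\mu}{2}\|\cdot\|^2$ is convex. The subdifferential is $\partial f(x)=\{v: f(y)\ge f(x)+\langle v,y-x\rangle\ \forall y\}$. For $\gamma>0$ and $h$ closed, convex, proper, $\mathrm{prox}_{\gamma h}(x)=\operatorname{argmin}_{z}\{h(z)+\frac{1}{2\gamma}\|z-x\|^2\}$ (the unique minimizer). *)

theory Defs
  imports "HOL-Analysis.Analysis"
begin

(* The library's epigraph is restricted to real-valued functions.  The height of a point of the
   epigraph is always a finite real, also where the function takes infinite values. *)
definition epi :: "('a \<Rightarrow> ereal) \<Rightarrow> ('a \<times> real) set" where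
  "epi h = {(x, t). h x \<le> ereal t}"

definition closed_fun :: "('a::topological_space \<Rightarrow> ereal) \<Rightarrow> bool" where
  "closed_fun h \<longleftrightarrow> closed (epi h)"

definition proper_fun :: "('a \<Rightarrow> ereal) \<Rightarrow> bool" where
  "proper_fun h \<longleftrightarrow> (\<forall>x. h x \<noteq> -\<infinity>) \<and> (\<exists>x. \<bar>h x\<bar> \<noteq> \<infinity>)"

definition convex_fun :: "('a::real_vector \<Rightarrow> ereal) \<Rightarrow> bool" where
  "convex_fun h \<longleftrightarrow> convex (epi h)"

definition strongly_convex_fun :: "real \<Rightarrow> ('a::real_normed_vector \<Rightarrow> ereal) \<Rightarrow> bool" where
  "strongly_convex_fun \<mu> h \<longleftrightarrow> convex_fun (\<lambda>x. h x - ereal (\<mu> / 2 * (norm x)\<^sup>2))"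

definition argmin :: "('a \<Rightarrow> ereal) \<Rightarrow> 'a set" where
  "argmin h = {x. is_arg_min h (\<lambda>_. True) x}"

definition subdifferential :: "('a::real_inner \<Rightarrow> ereal) \<Rightarrow> 'a \<Rightarrow> 'a set" where
  "subdifferential h x = {v. \<forall>y. h y \<ge> h x + ereal (v \<bullet> (y - x))}"

(* Meaningful for \<gamma> > 0 and h closed, convex and proper: then the minimizer exists and is
   unique. *)
definition prox :: "real \<Rightarrow> ('a::real_normed_vector \<Rightarrow> ereal) \<Rightarrow> 'a \<Rightarrow> 'a" where
  "prox \<gamma> h x = (THE z. z \<in> argmin (\<lambda>z. h z + ereal (1 / (2 * \<gamma>) * (norm (z - x))\<^sup>2)))"

end

theory Submission
  imports Defs
begin

text \<open>Write \<open>w\<^sub>k = x\<^sub>k - \<eta>\<^sub>k u\<^sub>k\<close>, and recentre so that the primal-dual solution is the origin. With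
  \<open>v = (x\<^sub>k + \<eta>\<^sub>k u\<^sub>k - y\<^sub>k\<^sub>+\<^sub>1) / \<eta>\<^sub>k\<close>, a subgradient of \<open>g\<close> at \<open>y = y\<^sub>k\<^sub>+\<^sub>1\<close>, one step reads
  \<open>x\<^sub>k + \<eta>\<^sub>k u\<^sub>k = y + \<eta>\<^sub>k v\<close> and \<open>x\<^sub>k\<^sub>+\<^sub>1 - \<eta>\<^sub>k\<^sub>+\<^sub>1 u\<^sub>k\<^sub>+\<^sub>1 = y - \<eta>\<^sub>k\<^sub>+\<^sub>1 v\<close>. The step sizes satisfy
  \<open>1 / \<eta>\<^sub>k\<^sub>+\<^sub>1 = 1 / \<eta>\<^sub>k + 2 \<mu>\<close>, so strong monotonicity \<open>v \<bullet> y \<ge> \<mu> \<parallel>y\<parallel>\<^sup>2\<close> is exactly what is needed for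
  \<open>\<parallel>y - \<eta>\<^sub>k\<^sub>+\<^sub>1 v\<parallel> / \<eta>\<^sub>k\<^sub>+\<^sub>1 \<le> \<parallel>y + \<eta>\<^sub>k v\<parallel> / \<eta>\<^sub>k\<close>, while monotonicity of the subdifferential of \<open>f\<close> gives
  \<open>u\<^sub>k \<bullet> x\<^sub>k \<le> 0\<close>, hence \<open>\<parallel>x\<^sub>k + \<eta>\<^sub>k u\<^sub>k\<parallel> \<le> \<parallel>x\<^sub>k - \<eta>\<^sub>k u\<^sub>k\<parallel>\<close> for \<open>k \<ge> 1\<close>. Therefore
  \<open>\<parallel>x\<^sub>k + \<eta>\<^sub>k u\<^sub>k\<parallel> / \<eta>\<^sub>k\<close> is nonincreasing, and Cauchy-Schwarz at \<open>k = 0\<close> gives the bound.\<close>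

section \<open>Strongly convex functions and their subgradients\<close>

lemma norm_convex_combination_sq:
  fixes a b :: "'a::real_inner"
  shows "(norm ((1 - l) *\<^sub>R a + l *\<^sub>R b))\<^sup>2 =
    (1 - l) * (norm a)\<^sup>2 + l * (norm b)\<^sup>2 - l * (1 - l) * (norm (b - a))\<^sup>2"
  unfolding power2_norm_eq_inner
  by (simp add: inner_add_left inner_add_right inner_diff_left
      inner_diff_right inner_commute algebra_simps power2_eq_square)

lemma strongly_convex_fun_zero: "strongly_convex_fun 0 h \<longleftrightarrow> convex_fun h"
  by (simp add: strongly_convex_fun_def)

text \<open>Convexity is applied to the epigraph of \<open>h\<close> minus the quadratic; adding the
  quadratic back leaves exactly the defect in \<open>norm_convex_combination_sq\<close>. Real upper
  bounds \<open>s\<close>, \<open>t\<close> in place of values keep infinities out.\<close>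

lemma strongly_convex_epi:
  fixes h :: "'a::real_inner \<Rightarrow> ereal"
  assumes "strongly_convex_fun \<mu> h" "h a \<le> ereal s" "h b \<le> ereal t" "0 \<le> l" "l \<le> 1"
  shows "h ((1 - l) *\<^sub>R a + l *\<^sub>R b) \<le>
    ereal ((1 - l) * s + l * t - \<mu> / 2 * l * (1 - l) * (norm (b - a))\<^sup>2)"
proof -
  let ?q = "\<lambda>z. \<mu> / 2 * (norm z)\<^sup>2"
  have epi: "(z, r) \<in> epi (\<lambda>z. h z - ereal (?q z)) \<longleftrightarrow> h z \<le> ereal (r + ?q z)" for z r
    by (cases "h z") (auto simp: epi_def)
  have "(1 - l) *\<^sub>R (a, s - ?q a) + l *\<^sub>R (b, t - ?q b) \<in> epi (\<lambda>z. h z - ereal (?q z))"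
    using assms unfolding strongly_convex_fun_def convex_fun_def
    by (intro convexD) (simp_all only: epi, simp_all)
  then have "h ((1 - l) *\<^sub>R a + l *\<^sub>R b) \<le>
      ereal ((1 - l) * (s - ?q a) + l * (t - ?q b) + ?q ((1 - l) *\<^sub>R a + l *\<^sub>R b))"
    by (simp only: epi scaleR_Pair add_Pair real_scaleR_def)
  also have "(1 - l) * (s - ?q a) + l * (t - ?q b) + ?q ((1 - l) *\<^sub>R a + l *\<^sub>R b) =
      (1 - l) * s + l * t - \<mu> / 2 * l * (1 - l) * (norm (b - a))\<^sup>2"
    unfolding norm_convex_combination_sq by (simp add: field_simps)
  finally show ?thesis .
qed

text \<open>With \<open>c = 0\<close> the hypothesis says that \<open>p\<close> is a subgradient at \<open>z\<close>; with \<open>c = 1 / \<gamma>\<close> and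
  \<open>p = (x - z) / \<gamma>\<close> it says that \<open>z\<close> minimizes the objective of \<open>prox \<gamma> h x\<close>.\<close>

lemma strongly_convex_subgradient:
  fixes h :: "'a::real_inner \<Rightarrow> ereal"
  assumes sc: "strongly_convex_fun \<mu> h" and "\<mu> \<ge> 0" "c \<ge> 0" and z: "h z \<le> ereal t"
    and le: "\<And>y s. h y \<le> ereal s \<Longrightarrow> t + p \<bullet> (y - z) \<le> s + c / 2 * (norm (y - z))\<^sup>2"
    and y: "h y \<le> ereal s"
  shows "t + p \<bullet> (y - z) + \<mu> / 2 * (norm (y - z))\<^sup>2 \<le> s"
proof (rule ccontr)
  define D where "D = (norm (y - z))\<^sup>2"
  define E where "E = t + p \<bullet> (y - z) + \<mu> / 2 * D - s"
  define K where "K = (\<mu> + c) / 2 * D"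
  assume "\<not> ?thesis"
  then have E: "E > 0" by (simp add: E_def D_def)
  have K: "K \<ge> 0" using assms by (simp add: K_def D_def)
  \<comment> \<open>\<open>le\<close> is tested at the point a fraction \<open>l\<close> of the way
    from \<open>z\<close> to \<open>y\<close>. Its quadratic error is of second order in
    \<open>l\<close>, so after division by \<open>l\<close> the gap \<open>E\<close> is of first
    order.\<close>
  have step: "E \<le> l * K" if l: "0 < l" "l < 1" for l
  proof -
    have eq: "(1 - l) *\<^sub>R z + l *\<^sub>R y - z = l *\<^sub>R (y - z)"
      by (simp add: algebra_simps)
    have n: "(norm (l *\<^sub>R (y - z)))\<^sup>2 = l\<^sup>2 * D"
      by (simp add: D_def power_mult_distrib)
    have "t + l * (p \<bullet> (y - z)) \<le>
        (1 - l) * t + l * s - \<mu> / 2 * l * (1 - l) * D + c / 2 * (l\<^sup>2 * D)"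
      using le[OF strongly_convex_epi[OF sc z y, of l]] l
      unfolding eq n D_def[symmetric] inner_scaleR_right by simp
    moreover have "l * E - l * (l * K) = t + l * (p \<bullet> (y - z)) -
        ((1 - l) * t + l * s - \<mu> / 2 * l * (1 - l) * D + c / 2 * (l\<^sup>2 * D))"
      unfolding E_def K_def by (simp add: power2_eq_square field_simps)
    ultimately have "l * E \<le> l * (l * K)" by linarith
    then show ?thesis using l by simp
  qed
  \<comment> \<open>This value of \<open>l\<close> lies strictly between 0 and 1 and gives
    \<open>l * K < E\<close>, contradicting \<open>step\<close>.\<close>
  have "E / (E + K + 1) * K < E"
    using E K by (simp add: pos_divide_less_eq)
  moreover have "0 < E / (E + K + 1)" "E / (E + K + 1) < 1"
    using E K by (auto simp: field_simps)
  ultimately show False using step by fastforce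
qed

section \<open>Existence, uniqueness and monotonicity of proximal points\<close>

lemma subdifferential_proper_finite:
  assumes "proper_fun h" "v \<in> subdifferential h a"
  obtains r where "h a = ereal r"
proof -
  have nm: "h a \<noteq> -\<infinity>" using assms(1) by (simp add: proper_fun_def)
  obtain b where b: "\<bar>h b\<bar> \<noteq> \<infinity>"
    using assms(1) unfolding proper_fun_def by metis
  have "h a + ereal (v \<bullet> (b - a)) \<le> h b"
    using assms(2) by (auto simp: subdifferential_def)
  with b nm have "\<bar>h a\<bar> \<noteq> \<infinity>" by auto
  with that show ?thesis by (metis ereal_real')
qed

text \<open>The minimum is attained by minimizing the continuous function
  \<open>(z, t) \<mapsto> t + \<parallel>z - x\<parallel>\<^sup>2 / (2 \<gamma>)\<close> over the closed epigraph; the affine minorant given by the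
  subgradient makes its sublevel sets bounded.\<close>

lemma prox_objective_attains_min:
  fixes h :: "'a::euclidean_space \<Rightarrow> ereal"
  assumes cl: "closed_fun h" and pr: "proper_fun h" and v: "v \<in> subdifferential h a"
    and "\<gamma> > 0"
  obtains z where "z \<in> argmin (\<lambda>z. h z + ereal (1 / (2 * \<gamma>) * (norm (z - x))\<^sup>2))"
proof -
  obtain r where r: "h a = ereal r"
    using subdifferential_proper_finite[OF pr v] .
  define F where "F = (\<lambda>p. snd p + 1 / (2 * \<gamma>) * (norm (fst p - x))\<^sup>2)"
  define M where "M = F (a, r)"
  define S where "S = epi h \<inter> {p. F p \<le> M}"
  have minorant: "r + v \<bullet> (z - a) \<le> t" if "(z, t) \<in> epi h" for z t
  proof -
    have "h a + ereal (v \<bullet> (z - a)) \<le> h z"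
      using v by (auto simp: subdifferential_def)
    also have "\<dots> \<le> ereal t" using that by (simp add: epi_def)
    finally show ?thesis by (simp add: r)
  qed
  have cont: "continuous_on A F" for A
    unfolding F_def by (intro continuous_intros)
  have "closed S"
    unfolding S_def using cl cont
    by (intro closed_Int closed_Collect_le continuous_on_const) (auto simp: closed_fun_def)
  moreover have "bounded S"
  proof -
    \<comment> \<open>Completing the square in \<open>F p \<le> M\<close> combined with the minorant
      gives a ball of radius \<open>R\<close> about \<open>x - \<gamma> *\<^sub>R v\<close>;
      Cauchy-Schwarz in the minorant then bounds the height below by \<open>m\<close>.\<close>
    define K where "K = M - r - v \<bullet> (x - a)"
    define R where "R = sqrt (2 * \<gamma> * K + \<gamma>\<^sup>2 * (norm v)\<^sup>2)"
    define m where "m = r - norm v * (R + norm (x - \<gamma> *\<^sub>R v - a))"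
    have "p \<in> cball (x - \<gamma> *\<^sub>R v) R \<times> {m..M}" if "p \<in> S" for p
    proof -
      obtain z t where p: "p = (z, t)" by fastforce
      have t: "r + v \<bullet> (z - a) \<le> t" using minorant that by (auto simp: S_def p)
      have FM: "t + 1 / (2 * \<gamma>) * (norm (z - x))\<^sup>2 \<le> M"
        using that by (auto simp: S_def p F_def)
      have "v \<bullet> (z - a) = v \<bullet> (z - x) + v \<bullet> (x - a)"
        by (simp add: inner_diff_right)
      with t FM have "1 / (2 * \<gamma>) * (norm (z - x))\<^sup>2 + v \<bullet> (z - x) \<le> K"
        by (simp add: K_def)
      then have "(norm (z - x))\<^sup>2 + 2 * \<gamma> * (v \<bullet> (z - x)) \<le> 2 * \<gamma> * K"
        using \<open>\<gamma> > 0\<close> by (simp add: field_simps)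
      moreover have "(norm (z - (x - \<gamma> *\<^sub>R v)))\<^sup>2 =
          (norm (z - x))\<^sup>2 + 2 * \<gamma> * (v \<bullet> (z - x)) + \<gamma>\<^sup>2 * (norm v)\<^sup>2"
        unfolding power2_norm_eq_inner
        by (simp add: inner_add_left inner_add_right inner_diff_left
            inner_diff_right inner_commute algebra_simps power2_eq_square)
      ultimately have z: "norm (z - (x - \<gamma> *\<^sub>R v)) \<le> R"
        unfolding R_def by (intro real_le_rsqrt) simp
      have "norm (z - a) \<le> norm (z - (x - \<gamma> *\<^sub>R v)) + norm (x - \<gamma> *\<^sub>R v - a)"
        using norm_triangle_ineq[of "z - (x - \<gamma> *\<^sub>R v)" "x - \<gamma> *\<^sub>R v - a"] by simp
      with z have "norm (z - a) \<le> R + norm (x - \<gamma> *\<^sub>R v - a)" by simp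
      then have "norm v * norm (z - a) \<le> norm v * (R + norm (x - \<gamma> *\<^sub>R v - a))"
        by (rule mult_left_mono) simp
      moreover have "- (v \<bullet> (z - a)) \<le> norm v * norm (z - a)"
        using norm_cauchy_schwarz[of "- v" "z - a"] by simp
      ultimately have "m \<le> t" using t by (simp add: m_def)
      moreover have "0 \<le> 1 / (2 * \<gamma>) * (norm (z - x))\<^sup>2"
        using \<open>\<gamma> > 0\<close> by simp
      with FM have "t \<le> M" by linarith
      ultimately show ?thesis using z by (simp add: p dist_norm norm_minus_commute)
    qed
    then have "S \<subseteq> cball (x - \<gamma> *\<^sub>R v) R \<times> {m..M}" by blast
    then show ?thesis
      by (rule bounded_subset[OF bounded_Times[OF bounded_cball bounded_closed_interval]])
  qed
  ultimately have "compact S" by (simp add: compact_eq_bounded_closed)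
  moreover have a: "(a, r) \<in> S" by (simp add: S_def M_def epi_def r)
  ultimately have "\<exists>p\<in>S. \<forall>q\<in>S. F p \<le> F q"
    using continuous_attains_inf[OF _ _ cont] by blast
  then obtain z t where zt: "(z, t) \<in> S" and min: "\<And>p. p \<in> S \<Longrightarrow> F (z, t) \<le> F p"
    by auto
  \<comment> \<open>Points of the epigraph outside \<open>S\<close> have \<open>F p > M\<close>,
    while \<open>F (z, t) \<le> M\<close>.\<close>
  have min': "F (z, t) \<le> F p" if "p \<in> epi h" for p
    using min[of p] min[OF a] that by (cases "F p \<le> M") (auto simp: S_def M_def)
  have "h z + ereal (1 / (2 * \<gamma>) * (norm (z - x))\<^sup>2)
      \<le> h y + ereal (1 / (2 * \<gamma>) * (norm (y - x))\<^sup>2)" for y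
  proof -
    have "h z + ereal (1 / (2 * \<gamma>) * (norm (z - x))\<^sup>2) \<le> ereal (F (z, t))"
      using zt by (cases "h z") (auto simp: S_def epi_def F_def)
    also have "\<dots> \<le> h y + ereal (1 / (2 * \<gamma>) * (norm (y - x))\<^sup>2)"
    proof (cases "h y")
      case (real s)
      then show ?thesis using min'[of "(y, s)"] by (simp add: epi_def F_def)
    qed (use pr in \<open>auto simp: proper_fun_def\<close>)
    finally show ?thesis .
  qed
  then show ?thesis
    by (intro that[of z]) (simp add: argmin_def is_arg_min_linorder)
qed

lemma prox_objective_argmin_finite:
  fixes h :: "'a::real_inner \<Rightarrow> ereal"
  assumes pr: "proper_fun h"
    and z: "z \<in> argmin (\<lambda>z. h z + ereal (1 / (2 * \<gamma>) * (norm (z - x))\<^sup>2))"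
  obtains t where "h z = ereal t"
proof -
  have nm: "h z \<noteq> -\<infinity>" using pr by (simp add: proper_fun_def)
  obtain b where b: "\<bar>h b\<bar> \<noteq> \<infinity>"
    using pr unfolding proper_fun_def by metis
  have "h z + ereal (1 / (2 * \<gamma>) * (norm (z - x))\<^sup>2) \<le> h b + ereal (1 / (2 * \<gamma>) * (norm (b - x))\<^sup>2)"
    using z by (simp add: argmin_def is_arg_min_linorder)
  with b nm have "\<bar>h z\<bar> \<noteq> \<infinity>" by auto
  with that show ?thesis by (metis ereal_real')
qed

lemma prox_objective_argmin_subgradient:
  fixes h :: "'a::real_inner \<Rightarrow> ereal"
  assumes sc: "strongly_convex_fun \<mu> h" and "\<mu> \<ge> 0" "\<gamma> > 0"
    and z: "z \<in> argmin (\<lambda>z. h z + ereal (1 / (2 * \<gamma>) * (norm (z - x))\<^sup>2))"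
    and t: "h z = ereal t" and y: "h y \<le> ereal s"
  shows "t + ((x - z) /\<^sub>R \<gamma>) \<bullet> (y - z) + \<mu> / 2 * (norm (y - z))\<^sup>2 \<le> s"
proof (rule strongly_convex_subgradient[OF sc \<open>\<mu> \<ge> 0\<close>, of "1 / \<gamma>"])
  fix y s assume y: "h y \<le> ereal s"
  have "h z + ereal (1 / (2 * \<gamma>) * (norm (z - x))\<^sup>2) \<le> h y + ereal (1 / (2 * \<gamma>) * (norm (y - x))\<^sup>2)"
    using z by (simp add: argmin_def is_arg_min_linorder)
  also have "\<dots> \<le> ereal s + ereal (1 / (2 * \<gamma>) * (norm (y - x))\<^sup>2)"
    using y by (rule add_right_mono)
  finally have "t + 1 / (2 * \<gamma>) * (norm (z - x))\<^sup>2 \<le> s + 1 / (2 * \<gamma>) * (norm (y - x))\<^sup>2"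
    by (simp add: t)
  moreover have "(norm (y - x))\<^sup>2 = (norm (z - x))\<^sup>2 - 2 * ((x - z) \<bullet> (y - z)) + (norm (y - z))\<^sup>2"
    by (simp add: power2_norm_eq_inner inner_diff_left inner_diff_right inner_commute)
  ultimately show "t + ((x - z) /\<^sub>R \<gamma>) \<bullet> (y - z) \<le> s + 1 / \<gamma> / 2 * (norm (y - z))\<^sup>2"
    using \<open>\<gamma> > 0\<close> unfolding inner_scaleR_left by (simp add: field_simps)
qed (use assms in auto)

text \<open>The subgradient \<open>v\<close> yields existence. For uniqueness, the subgradient
  inequalities at two minimizers add up to the squared distance over \<open>\<gamma>\<close> being
  at most 0.\<close>

lemma prox_in_argmin:
  fixes h :: "'a::euclidean_space \<Rightarrow> ereal"
  assumes "closed_fun h" "proper_fun h" "strongly_convex_fun \<mu> h" "\<mu> \<ge> 0" "\<gamma> > 0"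
    and "v \<in> subdifferential h a"
  shows "prox \<gamma> h x \<in> argmin (\<lambda>z. h z + ereal (1 / (2 * \<gamma>) * (norm (z - x))\<^sup>2))"
    (is "_ \<in> argmin ?F")
  unfolding prox_def
proof (rule theI')
  obtain z where z: "z \<in> argmin ?F"
    using prox_objective_attains_min[OF assms(1,2,6,5)] .
  moreover have "z' = z" if z': "z' \<in> argmin ?F" for z'
  proof -
    obtain t where t: "h z = ereal t"
      using prox_objective_argmin_finite[OF \<open>proper_fun h\<close> z] .
    obtain t' where t': "h z' = ereal t'"
      using prox_objective_argmin_finite[OF \<open>proper_fun h\<close> z'] .
    have nonneg: "0 \<le> \<mu> / 2 * (norm (z' - z))\<^sup>2" "0 \<le> \<mu> / 2 * (norm (z - z'))\<^sup>2"
      using \<open>\<mu> \<ge> 0\<close> by auto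
    have "t + ((x - z) /\<^sub>R \<gamma>) \<bullet> (z' - z) \<le> t'"
      using prox_objective_argmin_subgradient[OF assms(3-5) z t, of z' t'] t' nonneg
      by simp
    moreover have "t' + ((x - z') /\<^sub>R \<gamma>) \<bullet> (z - z') \<le> t"
      using prox_objective_argmin_subgradient[OF assms(3-5) z' t', of z t] t nonneg
      by simp
    ultimately have "((x - z) /\<^sub>R \<gamma>) \<bullet> (z' - z) + ((x - z') /\<^sub>R \<gamma>) \<bullet> (z - z') \<le> 0" by simp
    moreover have "((x - z) /\<^sub>R \<gamma>) \<bullet> (z' - z) + ((x - z') /\<^sub>R \<gamma>) \<bullet> (z - z')
        = (norm (z' - z))\<^sup>2 / \<gamma>"
      by (simp add: power2_norm_eq_inner inner_diff_left inner_diff_right inner_commute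
          divide_inverse algebra_simps)
    ultimately show ?thesis using \<open>\<gamma> > 0\<close> by (simp add: divide_le_0_iff)
  qed
  ultimately show "\<exists>!z. z \<in> argmin ?F" by blast
qed

text \<open>The subgradient inequalities at \<open>z\<close> and at \<open>a\<close>, each sharpened
  by half of the strong convexity term, are added; the function values cancel.\<close>

lemma prox_strongly_monotone:
  fixes h :: "'a::euclidean_space \<Rightarrow> ereal"
  assumes "closed_fun h" "proper_fun h" "strongly_convex_fun \<mu> h" "\<mu> \<ge> 0" "\<gamma> > 0"
    and v: "v \<in> subdifferential h a" and z: "z = prox \<gamma> h x"
  shows "\<mu> * (norm (z - a))\<^sup>2 \<le> ((x - z) /\<^sub>R \<gamma> - v) \<bullet> (z - a)"
proof -
  have am: "z \<in> argmin (\<lambda>z. h z + ereal (1 / (2 * \<gamma>) * (norm (z - x))\<^sup>2))"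
    using prox_in_argmin assms by blast
  obtain t where t: "h z = ereal t"
    using prox_objective_argmin_finite[OF \<open>proper_fun h\<close> am] .
  obtain r where r: "h a = ereal r"
    using subdifferential_proper_finite[OF \<open>proper_fun h\<close> v] .
  have "t + ((x - z) /\<^sub>R \<gamma>) \<bullet> (a - z) + \<mu> / 2 * (norm (a - z))\<^sup>2 \<le> r"
    using prox_objective_argmin_subgradient[OF assms(3-5) am t, of a r] by (simp add: r)
  moreover have "r + v \<bullet> (z - a) + \<mu> / 2 * (norm (z - a))\<^sup>2 \<le> t"
  proof (rule strongly_convex_subgradient[OF assms(3,4), of 0])
    fix y s assume y: "h y \<le> ereal s"
    have "h a + ereal (v \<bullet> (y - a)) \<le> h y"
      using v by (auto simp: subdifferential_def)
    from order_trans[OF this y] show "r + v \<bullet> (y - a) \<le> s + 0 / 2 * (norm (y - a))\<^sup>2"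
      by (simp add: r)
  qed (auto simp: r t)
  ultimately have "t + ((x - z) /\<^sub>R \<gamma>) \<bullet> (a - z) + r + v \<bullet> (z - a)
      + \<mu> * (norm (z - a))\<^sup>2 \<le> r + t"
    by (simp add: norm_minus_commute)
  moreover have "((x - z) /\<^sub>R \<gamma>) \<bullet> (a - z) = - (((x - z) /\<^sub>R \<gamma>) \<bullet> (z - a))"
    by (simp add: inner_diff_right)
  ultimately show ?thesis by (simp add: inner_diff_left)
qed

section \<open>Contraction of one step and the convergence rate\<close>

lemma strongly_monotone_reflection_contraction:
  fixes y v :: "'a::real_inner"
  assumes mono: "\<mu> * (norm y)\<^sup>2 \<le> v \<bullet> y" and "a > 0" "\<mu> \<ge> 0" and b: "b = a + 2 * \<mu>"
  shows "norm (b *\<^sub>R y - v) \<le> norm (a *\<^sub>R y + v)"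
proof -
  have "(norm (a *\<^sub>R y + v))\<^sup>2 - (norm (b *\<^sub>R y - v))\<^sup>2 = 2 * (a + b) * (v \<bullet> y - \<mu> * (norm y)\<^sup>2)"
    unfolding power2_norm_eq_inner b
    by (simp add: inner_add_left inner_add_right inner_diff_left
        inner_diff_right inner_commute algebra_simps power2_eq_square)
  also have "\<dots> \<ge> 0" using assms by simp
  finally show ?thesis
    using power2_le_imp_le[of "norm (b *\<^sub>R y - v)" "norm (a *\<^sub>R y + v)"] by simp
qed

theorem theorem1:
  fixes N :: nat and \<mu> :: real
    and f g :: "real ^ 'd \<Rightarrow> ereal"
    and xstar ustar u\<^sub>0 :: "real ^ 'd"
    and \<eta> :: "nat \<Rightarrow> real"
    and x y w :: "nat \<Rightarrow> real ^ 'd"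
  assumes "N \<ge> 1" and "\<mu> > 0"
    and "closed_fun f" and "convex_fun f" and "proper_fun f"
    and "closed_fun g" and "proper_fun g" and "strongly_convex_fun \<mu> g"
    and "xstar \<in> argmin (\<lambda>z. f z + g z)"
    and "ustar \<in> subdifferential g xstar"
    and "- ustar \<in> subdifferential f xstar"
    and "\<And>k. k \<le> N \<Longrightarrow> \<eta> k = 2 * real N * \<mu> / (1 + 4 * real k * real N * \<mu>\<^sup>2)"
    and "w 0 = x 0 - \<eta> 0 *\<^sub>R u\<^sub>0"
    and "\<And>k. k < N \<Longrightarrow> y (Suc k) = prox (\<eta> k) g (2 *\<^sub>R x k - w k)"
    and "\<And>k. k < N \<Longrightarrow> w (Suc k) =
           (1 + \<eta> (Suc k) / \<eta> k) *\<^sub>R y (Suc k) - (\<eta> (Suc k) / \<eta> k) *\<^sub>R (2 *\<^sub>R x k - w k)"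
    and "\<And>k. k < N \<Longrightarrow> x (Suc k) = prox (\<eta> (Suc k)) f (w (Suc k))"
  shows "(norm (x N - xstar))\<^sup>2 \<le>
           ((norm (x 0 - xstar))\<^sup>2 + (norm (u\<^sub>0 - ustar))\<^sup>2) / (1 + 4 * (real N)\<^sup>2 * \<mu>\<^sup>2)"
proof -
  note N = assms(1) and \<mu> = assms(2) and \<eta> = assms(12)
  have pos: "0 < 1 + 4 * real k * real N * \<mu>\<^sup>2" for k
    by (intro add_pos_nonneg) auto
  have \<eta>_pos: "\<eta> k > 0" if "k \<le> N" for k
    using \<eta>[OF that] pos[of k] N \<mu> by simp
  have \<eta>_Suc: "1 / \<eta> (Suc k) = 1 / \<eta> k + 2 * \<mu>" if "k < N" for k
    using that pos[of k] pos[of "Suc k"] N \<mu>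
    by (simp add: \<eta> field_simps power2_eq_square)
  \<comment> \<open>Recovers the dual iterate from \<open>w\<close>; for \<open>k \<ge> 1\<close>,
    \<open>- u k\<close> is the subgradient of \<open>f\<close> at \<open>x k\<close> produced by
    the prox, and \<open>u 0\<close> is the given \<open>u\<^sub>0\<close>.\<close>
  define u where "u = (\<lambda>k. (x k - w k) /\<^sub>R \<eta> k)"
  define X where "X = (\<lambda>k. x k - xstar)"
  define U where "U = (\<lambda>k. u k - ustar)"
  have step: "norm (X (Suc k) /\<^sub>R \<eta> (Suc k) - U (Suc k)) \<le> norm (X k /\<^sub>R \<eta> k + U k)"
    if k: "k < N" for k
  proof -
    let ?a = "\<eta> k" and ?b = "\<eta> (Suc k)"
    define v where "v = (2 *\<^sub>R x k - w k - y (Suc k)) /\<^sub>R ?a"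
    define Y where "Y = y (Suc k) - xstar"
    have a: "?a > 0" and b: "?b > 0" using \<eta>_pos k by auto
    have "\<mu> * (norm Y)\<^sup>2 \<le> (v - ustar) \<bullet> Y"
      unfolding v_def Y_def
      using prox_strongly_monotone[OF assms(6-8) _ a assms(10) assms(14)[OF k]] \<mu> by simp
    then have "norm ((1 / ?b) *\<^sub>R Y - (v - ustar)) \<le> norm ((1 / ?a) *\<^sub>R Y + (v - ustar))"
      using strongly_monotone_reflection_contraction[OF _ _ _ \<eta>_Suc[OF k]] a \<mu> by simp
    moreover have "(1 / ?a) *\<^sub>R Y + (v - ustar) = X k /\<^sub>R ?a + U k"
      by (simp add: X_def U_def u_def v_def Y_def divide_inverse algebra_simps scaleR_2)
    moreover have "(1 / ?b) *\<^sub>R Y - (v - ustar) = X (Suc k) /\<^sub>R ?b - U (Suc k)"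
    proof -
      have "w (Suc k) = y (Suc k) - ?b *\<^sub>R v"
        unfolding assms(15)[OF k] v_def using a by (simp add: divide_inverse algebra_simps)
      then have "w (Suc k) /\<^sub>R ?b = y (Suc k) /\<^sub>R ?b - v"
        using b by (simp add: scaleR_diff_right)
      then show ?thesis
        by (simp add: X_def U_def u_def Y_def divide_inverse algebra_simps)
    qed
    ultimately show ?thesis by simp
  qed
  have mono_f: "U (Suc k) \<bullet> X (Suc k) \<le> 0" if k: "k < N" for k
  proof -
    have "0 \<le> ((w (Suc k) - x (Suc k)) /\<^sub>R \<eta> (Suc k) - - ustar) \<bullet> X (Suc k)"
      unfolding X_def
      using prox_strongly_monotone[of f 0 "\<eta> (Suc k)", OF assms(3,5) _ _ _ assms(11) assms(16)[OF k]]
        \<eta>_pos[of "Suc k"] k assms(4) by (simp add: strongly_convex_fun_zero)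
    also have "(w (Suc k) - x (Suc k)) /\<^sub>R \<eta> (Suc k) - - ustar = - U (Suc k)"
      by (simp add: U_def u_def algebra_simps)
    finally show ?thesis by simp
  qed
  have sq: "(norm (X k /\<^sub>R \<eta> k - U k))\<^sup>2 =
      (norm (X k) / \<eta> k)\<^sup>2 + (norm (U k))\<^sup>2 - 2 / \<eta> k * (U k \<bullet> X k)"
    "(norm (X k /\<^sub>R \<eta> k + U k))\<^sup>2 =
      (norm (X k) / \<eta> k)\<^sup>2 + (norm (U k))\<^sup>2 + 2 / \<eta> k * (U k \<bullet> X k)" for k
    unfolding power_divide power2_norm_eq_inner
    by (simp_all add: inner_add_left inner_add_right inner_diff_left
        inner_diff_right inner_commute divide_inverse algebra_simps power2_eq_square)
  have decr: "norm (X k /\<^sub>R \<eta> k + U k) \<le> norm (X 0 /\<^sub>R \<eta> 0 + U 0)" if "k \<le> N" for k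
    using that
  proof (induction k)
    case (Suc k)
    then have k: "k < N" by simp
    have "2 / \<eta> (Suc k) * (U (Suc k) \<bullet> X (Suc k)) \<le> 0"
      using mono_f[OF k] \<eta>_pos[OF Suc.prems] by (intro mult_nonneg_nonpos) auto
    then have "(norm (X (Suc k) /\<^sub>R \<eta> (Suc k) + U (Suc k)))\<^sup>2
        \<le> (norm (X (Suc k) /\<^sub>R \<eta> (Suc k) - U (Suc k)))\<^sup>2"
      unfolding sq by linarith
    then have "norm (X (Suc k) /\<^sub>R \<eta> (Suc k) + U (Suc k))
        \<le> norm (X (Suc k) /\<^sub>R \<eta> (Suc k) - U (Suc k))"
      by (rule power2_le_imp_le) simp
    with step[OF k] Suc show ?case by simp
  qed simp
  \<comment> \<open>The last step stops before the sign flip: as \<open>N \<ge> 1\<close>, the cross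
    term at \<open>N\<close> has the right sign, so it and the norm of \<open>U N\<close> can both
    be dropped.\<close>
  obtain n where n: "N = Suc n" using N by (cases N) auto
  have "2 / \<eta> N * (U N \<bullet> X N) \<le> 0"
    using mono_f[of n] \<eta>_pos[of N] by (intro mult_nonneg_nonpos) (auto simp: n)
  then have "(norm (X N) / \<eta> N)\<^sup>2 \<le> (norm (X N /\<^sub>R \<eta> N - U N))\<^sup>2"
    unfolding sq using zero_le_power2[of "norm (U N)"] by linarith
  also have "\<dots> \<le> (norm (X 0 /\<^sub>R \<eta> 0 + U 0))\<^sup>2"
    using step[of n] decr[of n] by (intro power_mono) (auto simp: n)
  finally have "norm (X N) / \<eta> N \<le> norm (X 0 /\<^sub>R \<eta> 0 + U 0)"
    by (rule power2_le_imp_le) simp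
  also have "\<dots> \<le> norm (X 0) / \<eta> 0 + norm (U 0)"
    using norm_triangle_ineq[of "X 0 /\<^sub>R \<eta> 0" "U 0"] \<eta>_pos[of 0]
    by (simp add: divide_inverse mult.commute)
  finally have le: "norm (X N) \<le> \<eta> N / \<eta> 0 * (norm (X 0) + \<eta> 0 * norm (U 0))"
    using \<eta>_pos[of N] \<eta>_pos[of 0] by (simp add: field_simps)
  \<comment> \<open>Since \<open>\<eta> 0 = 2 * N * \<mu>\<close>, this is the denominator of the
    bound, and also the ratio of \<open>\<eta> 0\<close> to \<open>\<eta> N\<close>.\<close>
  define c where "c = 1 + (\<eta> 0)\<^sup>2"
  have c: "c = 1 + 4 * (real N)\<^sup>2 * \<mu>\<^sup>2"
    by (simp add: c_def \<eta> power_mult_distrib)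
  have c_pos: "c > 0" by (simp add: c_def add_pos_nonneg)
  have "\<eta> N / \<eta> 0 = 1 / c"
    using N \<mu> by (simp add: \<eta> c power2_eq_square)
  with le have "c * norm (X N) \<le> norm (X 0) + \<eta> 0 * norm (U 0)"
    using c_pos by (simp add: field_simps)
  then have "(c * norm (X N))\<^sup>2 \<le> (norm (X 0) + \<eta> 0 * norm (U 0))\<^sup>2"
    using c_pos by (intro power_mono) auto
  \<comment> \<open>Cauchy-Schwarz for the vectors \<open>(1, \<eta> 0)\<close> and
    \<open>(norm (X 0), norm (U 0))\<close>; one factor \<open>c\<close> then cancels against the
    square on the left.\<close>
  also have "\<dots> \<le> c * ((norm (X 0))\<^sup>2 + (norm (U 0))\<^sup>2)"
    using zero_le_power2[of "\<eta> 0 * norm (X 0) - norm (U 0)"]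
    by (simp add: c_def power2_eq_square algebra_simps)
  finally have "c * (norm (X N))\<^sup>2 \<le> (norm (X 0))\<^sup>2 + (norm (U 0))\<^sup>2"
    using c_pos by (simp add: power2_eq_square mult_ac)
  moreover have "u 0 = u\<^sub>0"
    using \<eta>_pos[of 0] by (simp add: u_def assms(13))
  ultimately show ?thesis
    using c_pos unfolding c[symmetric] by (simp add: X_def U_def field_simps)
qed

end
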